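(* Let $X$ be a path-connected topological space, let $n\ge 1$, and let $Y\subseteq X^{n}$ be a subspace. Then $\mathrm{TC}_{n,X}(Y)\le \mathrm{cat}_{X^{n}}(Y)$.
   Context: For continuous maps $f_1,\dots,f_m : A\to B$, the higher homotopic distance $\mathrm{D}(f_1,\dots,f_m)$ is the least positive integer $r$ such that $A$ has an open cover $\{A_1,\dots,A_r\}$ with $f_1|_{A_i}\simeq f_2|_{A_i}\simeq\cdots\simeq f_m|_{A_i}$ (as maps $A_i\to B$) for every $i$ (and $\infty$ if no such $r$ exists); for a single map ($m=1$) it is $1$. For $X$ path-connected and $Y\subseteq X^{n}$, the relative higher topological complexity is $\mathrm{TC}_{n,X}(Y)=\mathrm{D}(p_1|_Y,\dots,p_n|_Y)$, where $p_i : X^{n}\to X$ is the projection onto the $i$-th factor. The relative Lusternik-Schnirelmann category is $\mathrm{cat}_{X^{n}}(Y)=\mathrm{D}(i_Y,\ast)$, where $i_Y : Y\to X^{n}$ is the inclusion and $\ast : Y\to X^{n}$ is a constant map; i.e. the least number of open subsets of $Y$ that cover $Y$ and whose inclusions into $X^{n}$ are null-homotopic. *)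

theory Defs
  imports "HOL-Analysis.Analysis" "HOL-Library.Extended_Nat"
begin

text \<open>The pieces of a cover are indexed by \<open>{1..r}\<close>, so they may repeat or be empty; this does not
  affect the least \<open>r\<close>. The infimum of the empty set in \<^typ>\<open>enat\<close> is \<open>\<infinity>\<close>. The definition is
  meant for lists of continuous maps from \<open>A\<close> to \<open>B\<close>; for a single map it gives \<open>1\<close>.\<close>

definition homotopic_distance ::
  "'a topology \<Rightarrow> 'b topology \<Rightarrow> ('a \<Rightarrow> 'b) list \<Rightarrow> enat" where
  "homotopic_distance A B fs =
     (INF r \<in> {r::nat. r \<ge> 1 \<and>
        (\<exists>U :: nat \<Rightarrow> 'a set.
           (\<forall>i\<in>{1..r}. openin A (U i)) \<and>
           (\<Union>i\<in>{1..r}. U i) = topspace A \<and>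
           (\<forall>i\<in>{1..r}. successively
              (\<lambda>f g. homotopic_with (\<lambda>_. True) (subtopology A (U i)) B f g) fs))}.
      enat r)"

abbreviation power_space :: "'a topology \<Rightarrow> nat \<Rightarrow> (nat \<Rightarrow> 'a) topology" where
  "power_space X n \<equiv> product_topology (\<lambda>_. X) {1..n}"

definition rel_TC :: "nat \<Rightarrow> 'a topology \<Rightarrow> (nat \<Rightarrow> 'a) set \<Rightarrow> enat" where
  "rel_TC n X Y =
     homotopic_distance (subtopology (power_space X n) Y) X (map (\<lambda>i y. y i) [1..<Suc n])"

text \<open>The value of the constant map is an arbitrary point of \<open>W\<close>. For path-connected \<open>W\<close> the choice
  is irrelevant, see \<open>rel_cat_eq\<close> and \<open>rel_cat_eq_nullhomotopic\<close> below. If \<open>W\<close> is empty then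
  \<open>Y\<close> is empty as well and the constant map is the empty map.\<close>

definition rel_cat :: "'b topology \<Rightarrow> 'b set \<Rightarrow> enat" where
  "rel_cat W Y =
     homotopic_distance (subtopology W Y) W [\<lambda>y. y, \<lambda>_. SOME w. w \<in> topspace W]"

lemma homotopic_to_constant_cong:
  assumes "path_connected_space W" "a \<in> topspace W" "b \<in> topspace W"
    and "homotopic_with (\<lambda>_. True) S W f (\<lambda>_. a)"
  shows "homotopic_with (\<lambda>_. True) S W f (\<lambda>_. b)"
proof -
  have "homotopic_with (\<lambda>_. True) S W (\<lambda>_. a) (\<lambda>_. b)"
    using assms(1-3)
    by (simp add: homotopic_constant_maps path_connected_space_iff_path_component)
  with assms(4) show ?thesis
    by (rule homotopic_with_trans)
qed

lemma rel_cat_eq: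
  assumes "path_connected_space W" "w \<in> topspace W"
  shows "rel_cat W Y = homotopic_distance (subtopology W Y) W [\<lambda>y. y, \<lambda>_. w]"
proof -
  have s: "(SOME w. w \<in> topspace W) \<in> topspace W"
    using assms(2) by (rule someI)
  have "homotopic_with (\<lambda>_. True) S W (\<lambda>y. y) (\<lambda>_. SOME w. w \<in> topspace W)
      \<longleftrightarrow> homotopic_with (\<lambda>_. True) S W (\<lambda>y. y) (\<lambda>_. w)" for S
    using homotopic_to_constant_cong[OF assms(1)] assms(2) s by blast
  then show ?thesis
    by (simp add: rel_cat_def homotopic_distance_def)
qed

lemma rel_cat_eq_nullhomotopic:
  assumes "path_connected_space W" "topspace W \<noteq> {}"
  shows "rel_cat W Y =
     (INF r \<in> {r::nat. r \<ge> 1 \<and>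
        (\<exists>U :: nat \<Rightarrow> 'b set.
           (\<forall>i\<in>{1..r}. openin (subtopology W Y) (U i)) \<and>
           (\<Union>i\<in>{1..r}. U i) = topspace (subtopology W Y) \<and>
           (\<forall>i\<in>{1..r}. \<exists>w\<in>topspace W.
              homotopic_with (\<lambda>_. True) (subtopology (subtopology W Y) (U i)) W
                (\<lambda>y. y) (\<lambda>_. w)))}.
      enat r)"
proof -
  have s: "(SOME w. w \<in> topspace W) \<in> topspace W"
    using assms(2) by (simp add: some_in_eq)
  have "homotopic_with (\<lambda>_. True) S W (\<lambda>y. y) (\<lambda>_. SOME w. w \<in> topspace W)
      \<longleftrightarrow> (\<exists>w\<in>topspace W. homotopic_with (\<lambda>_. True) S W (\<lambda>y. y) (\<lambda>_. w))" for S
    using homotopic_to_constant_cong[OF assms(1)] s by blast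
  then show ?thesis
    by (simp add: rel_cat_def homotopic_distance_def)
qed

end

theory Submission
  imports Defs
begin

text \<open>An open piece whose inclusion into the power of \<open>X\<close> is null-homotopic is
  also a piece for the projections: composing the null-homotopy with the i-th projection deforms it
  to a constant map, and since \<open>X\<close> is path-connected all these constants are homotopic.
  Hence every categorical cover of \<open>Y\<close> is admissible for \<open>rel_TC\<close>
  (\<open>homotopic_with_composites_if_null_homotopic\<close>), and the infima compare by
  \<open>homotopic_distance_mono\<close>.\<close>

text \<open>The same cover serves both sides, so the set of admissible \<open>r\<close> for
  \<open>gs\<close> is contained in that for \<open>fs\<close>, and the infimum over the larger set
  is smaller.\<close>

lemma homotopic_distance_mono:
  assumes "\<And>U. \<lbrakk>openin A U;
      successively (\<lambda>f g. homotopic_with (\<lambda>_. True) (subtopology A U) C f g) gs\<rbrakk>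
    \<Longrightarrow> successively (\<lambda>f g. homotopic_with (\<lambda>_. True) (subtopology A U) B f g) fs"
  shows "homotopic_distance A B fs \<le> homotopic_distance A C gs"
  unfolding homotopic_distance_def
  by (intro INF_superset_mono subsetI CollectI order_refl; elim CollectE conjE exE;
      intro conjI exI ballI; (rule assms)?; (assumption | erule (1) bspec))

text \<open>Chain of homotopies: \<open>p \<circ> f\<close> to the constant \<open>p w\<close>,
  along a path in \<open>X\<close> to the constant \<open>q w\<close>, and back to
  \<open>q \<circ> f\<close>.\<close>

lemma homotopic_with_composites_if_null_homotopic:
  assumes "path_connected_space X"
    and null: "homotopic_with (\<lambda>_. True) S W f (\<lambda>_. w)"
    and "continuous_map W X p" "continuous_map W X q"
  shows "homotopic_with (\<lambda>_. True) S X (p \<circ> f) (q \<circ> f)"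
proof -
  have to_const: "homotopic_with (\<lambda>_. True) S X (r \<circ> f) (\<lambda>_. r w)"
    if "continuous_map W X r" for r
    using homotopic_with_compose_continuous_map_left[OF null that, of "\<lambda>_. True"]
    by (simp add: comp_def)
  have "homotopic_with (\<lambda>_. True) S X (\<lambda>_. p w) (\<lambda>_. q w)"
  \<comment> \<open>A point of \<open>S\<close> is what forces \<open>p w\<close> and
    \<open>q w\<close> into \<open>X\<close>, as \<open>w\<close> is not assumed to lie in
    \<open>W\<close>; over the empty space any two maps are homotopic.\<close>
  proof (cases "S = trivial_topology")
    case False
    then obtain s where "s \<in> topspace S"
      by fastforce
    then have "p w \<in> topspace X" "q w \<in> topspace X"
      using homotopic_with_imp_continuous_maps[OF to_const] assms(3,4)
        continuous_map_funspace[THEN funcset_mem] by metis+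
    with assms(1) show ?thesis
      by (simp add: homotopic_constant_maps path_connected_space_iff_path_component)
  qed (simp add: homotopic_on_empty)
  with to_const[OF assms(3)] have "homotopic_with (\<lambda>_. True) S X (p \<circ> f) (\<lambda>_. q w)"
    by (rule homotopic_with_trans)
  then show ?thesis
    by (rule homotopic_with_trans[OF _ homotopic_with_symD[OF to_const[OF assms(4)]]])
qed

theorem corollary3p9:
  fixes X :: "'a topology" and n :: nat and Y :: "(nat \<Rightarrow> 'a) set"
  assumes "path_connected_space X"
    and "n \<ge> 1"
    and "Y \<subseteq> topspace (power_space X n)"
  shows "rel_TC n X Y \<le> rel_cat (power_space X n) Y"
  unfolding rel_TC_def rel_cat_def
proof (rule homotopic_distance_mono)
  fix U
  let ?S = "subtopology (subtopology (power_space X n) Y) U"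
  assume "successively (\<lambda>f g. homotopic_with (\<lambda>_. True) ?S (power_space X n) f g)
    [\<lambda>y. y, \<lambda>_. SOME w. w \<in> topspace (power_space X n)]"
  \<comment> \<open>Here \<open>f\<close> is the inclusion \<open>\<lambda>y. y\<close>, so its
    composites with the projections are the coordinate maps on the piece.\<close>
  then have "homotopic_with (\<lambda>_. True) ?S X (\<lambda>y. y i) (\<lambda>y. y j)"
    if "i \<in> {1..n}" "j \<in> {1..n}" for i j
    using homotopic_with_composites_if_null_homotopic[OF assms(1) _
        continuous_map_product_projection[OF that(1)]
        continuous_map_product_projection[OF that(2)]]
    by (simp add: comp_def)
  then show "successively (\<lambda>f g. homotopic_with (\<lambda>_. True) ?S X f g)
      (map (\<lambda>i y. y i) [1..<Suc n])"
    by (auto simp: successively_conv_nth simp del: upt_Suc)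
qed

end
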